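(* Let $\underline{L} = (L,\vee)$ be a semilattice, let $(x_i \mid i\in I)$ be an enumeration, with finite index set $I$, of a finite generating set $\{x_i \mid i\in I\}\subseteq L$ of $\underline{L}$, and let $\le_I$ be a total order on $I$. Let $a\in L$. Then the next element $a^+\in L$ after $a$ with respect to $<$, if it exists, is given by \[ a^+ = a\oplus i \] with $i\in I$ being maximal (with respect to $\le_I$) such that $a <_i a\oplus i$.
   Context: A semilattice $\underline{L}=(L,\vee)$ is a set $L$ with a binary operation $\vee$ that is associative, commutative and idempotent. Its order is given by $x\le_{\underline{L}} y :\iff x\vee y = y$, so that $x\vee y$ is the least upper bound of $x$ and $y$. That $\{x_i\mid i\in I\}$ generates $\underline{L}$ means that every element of $L$ is a join of finitely many (at least one) of the $x_i$. Write $<_I$ for the strict part of $\le_I$. For $a,b\in L$ define \[ \Delta_{a,b} := \{ j\in I \mid (x_j\le_{\underline{L}} a \text{ and } x_j\not\le_{\underline{L}} b) \text{ or } (x_j\not\le_{\underline{L}} a \text{ and } x_j\le_{\underline{L}} b)\}. \] For $i\in I$ define $a <_i b :\iff i = \min\Delta_{a,b}$ (minimum with respect to $\le_I$; in particular $\Delta_{a,b}\neq\emptyset$) and $x_i\le_{\underline{L}} b$. Write $a<b$ if $a<_i b$ for some $i\in I$, and $a\le b$ if $a=b$ or $a<b$. (The relation $\le$ is a total order on $L$.) For $a\in L$ and $i\in I$ define \[ a\oplus i := \Bigl(\bigvee_{j<_I i,\ x_j\le_{\underline{L}} a} x_j\Bigr)\vee x_i, \] i.e. the join of $x_i$ together with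 all $x_j$ such that $j<_I i$ and $x_j\le_{\underline{L}} a$ (if there is no such $j$, then $a\oplus i = x_i$). The next element $a^+$ after $a$ with respect to $<$ is the smallest element, with respect to $\le$, of $\{b\in L\mid a<b\}$; it exists if and only if this set has a smallest element. *)

theory Defs
  imports Main
begin

text \<open>
  The semilattice is a type of class \<^class>\<open>semilattice_sup\<close>, whose order satisfies
  \<open>x \<le> y \<longleftrightarrow> sup x y = y\<close>. The index set is a finite subset of an arbitrary linearly
  ordered type.
\<close>

definition generates :: "'a::semilattice_sup set \<Rightarrow> bool" where
  "generates X \<longleftrightarrow> (\<forall>y. \<exists>F. F \<subseteq> X \<and> finite F \<and> F \<noteq> {} \<and> y = Sup_fin F)"

definition Delta :: "'i set \<Rightarrow> ('i \<Rightarrow> 'a::semilattice_sup) \<Rightarrow> 'a \<Rightarrow> 'a \<Rightarrow> 'i set" where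
  "Delta I x a b = {j \<in> I. (x j \<le> a \<and> \<not> x j \<le> b) \<or> (\<not> x j \<le> a \<and> x j \<le> b)}"

definition less_at ::
  "'i::linorder set \<Rightarrow> ('i \<Rightarrow> 'a::semilattice_sup) \<Rightarrow> 'i \<Rightarrow> 'a \<Rightarrow> 'a \<Rightarrow> bool" where
  "less_at I x i a b \<longleftrightarrow> Delta I x a b \<noteq> {} \<and> i = Min (Delta I x a b) \<and> x i \<le> b"

definition lectic_less ::
  "'i::linorder set \<Rightarrow> ('i \<Rightarrow> 'a::semilattice_sup) \<Rightarrow> 'a \<Rightarrow> 'a \<Rightarrow> bool" where
  "lectic_less I x a b \<longleftrightarrow> (\<exists>i\<in>I. less_at I x i a b)"

definition lectic_le ::
  "'i::linorder set \<Rightarrow> ('i \<Rightarrow> 'a::semilattice_sup) \<Rightarrow> 'a \<Rightarrow> 'a \<Rightarrow> bool" where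
  "lectic_le I x a b \<longleftrightarrow> a = b \<or> lectic_less I x a b"

definition oplus ::
  "'i::linorder set \<Rightarrow> ('i \<Rightarrow> 'a::semilattice_sup) \<Rightarrow> 'a \<Rightarrow> 'i \<Rightarrow> 'a" where
  "oplus I x a i = Sup_fin (insert (x i) (x ` {j \<in> I. j < i \<and> x j \<le> a}))"

text \<open>\<open>is_next I x a c\<close>: the element \<open>a\<^sup>+\<close> exists and equals \<open>c\<close>.\<close>

definition is_next ::
  "'i::linorder set \<Rightarrow> ('i \<Rightarrow> 'a::semilattice_sup) \<Rightarrow> 'a \<Rightarrow> 'a \<Rightarrow> bool" where
  "is_next I x a c \<longleftrightarrow> lectic_less I x a c \<and> (\<forall>b. lectic_less I x a b \<longrightarrow> lectic_le I x c b)"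

end

theory Submission imports Defs begin

text \<open>Let \<open>i\<close> be the index at which \<open>a\<close> first differs from
  \<open>a_plus\<close>. Then \<open>oplus I x a i\<close> is the semilattice-least element lying
  above \<open>a\<close> at index \<open>i\<close>, hence below \<open>a_plus\<close>; minimality of
  \<open>a_plus\<close> forces equality (\<open>less_at_imp_oplus_le\<close>,
  \<open>less_at_imp_less_at_oplus\<close>, \<open>less_at_imp_not_le\<close>). The index is maximal
  because, among elements lectically above \<open>a\<close>, a smaller one first differs from
  \<open>a\<close> at a later or equal index (\<open>less_at_index_antimono\<close>).\<close>

lemma less_at_iff:
  fixes I :: "'i::linorder set" and x :: "'i \<Rightarrow> 'a::semilattice_sup"
  assumes "finite I"
  shows "less_at I x i a b \<longleftrightarrow>
    i \<in> I \<and> \<not> x i \<le> a \<and> x i \<le> b \<and> (\<forall>j\<in>I. j < i \<longrightarrow> (x j \<le> a \<longleftrightarrow> x j \<le> b))"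
    (is "_ \<longleftrightarrow> ?R")
proof -
  have fin: "finite (Delta I x a b)"
    using assms by (simp add: Delta_def)
  have "less_at I x i a b \<longleftrightarrow>
      i \<in> Delta I x a b \<and> (\<forall>j\<in>Delta I x a b. i \<le> j) \<and> x i \<le> b"
    unfolding less_at_def using fin by (metis Min_eq_iff empty_iff)
  also have "\<dots> \<longleftrightarrow> ?R"
    by (auto simp: Delta_def not_less[symmetric])
  finally show ?thesis .
qed

lemma oplus_le_iff:
  fixes I :: "'i::linorder set" and x :: "'i \<Rightarrow> 'a::semilattice_sup"
  assumes "finite I"
  shows "oplus I x a i \<le> b \<longleftrightarrow> x i \<le> b \<and> (\<forall>j\<in>I. j < i \<and> x j \<le> a \<longrightarrow> x j \<le> b)"
  unfolding oplus_def using assms by (subst Sup_fin.bounded_iff) auto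

lemma less_at_imp_oplus_le:
  fixes I :: "'i::linorder set" and x :: "'i \<Rightarrow> 'a::semilattice_sup"
  assumes "finite I" and "less_at I x i a b"
  shows "oplus I x a i \<le> b"
  using assms by (auto simp: less_at_iff oplus_le_iff)

text \<open>The join is squeezed: for \<open>j < i\<close>, \<open>x j \<le> a\<close> puts
  \<open>x j\<close> into the join, while \<open>x j\<close> below the join is below
  \<open>b\<close>, hence below \<open>a\<close>, as \<open>a\<close> and \<open>b\<close> agree
  before \<open>i\<close>.\<close>

lemma less_at_imp_less_at_oplus:
  fixes I :: "'i::linorder set" and x :: "'i \<Rightarrow> 'a::semilattice_sup"
  assumes fin: "finite I" and less: "less_at I x i a b"
  shows "less_at I x i a (oplus I x a i)"
  using less less_at_imp_oplus_le[OF assms] oplus_le_iff[OF fin, of x a i "oplus I x a i"]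
  by (auto simp: less_at_iff[OF fin] intro: order_trans)

text \<open>The generator \<open>x i\<close> itself separates \<open>b\<close> from
  \<open>a\<close>.\<close>

lemma less_at_imp_not_le:
  fixes I :: "'i::linorder set" and x :: "'i \<Rightarrow> 'a::semilattice_sup"
  assumes "finite I" and "less_at I x i a b"
  shows "\<not> b \<le> a"
  using assms by (auto simp: less_at_iff intro: order_trans)

lemma less_at_index_antimono:
  fixes I :: "'i::linorder set" and x :: "'i \<Rightarrow> 'a::semilattice_sup"
  assumes fin: "finite I"
    and b: "less_at I x i a b" and c: "less_at I x k a c" and le: "lectic_le I x b c"
  shows "k \<le> i"
proof (rule ccontr)
  assume "\<not> k \<le> i"
  then have ik: "i < k" by simp
  with b c have xi: "i \<in> I" "x i \<le> b" "\<not> x i \<le> c"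
    by (auto simp: less_at_iff[OF fin])
  \<comment> \<open>The generator \<open>x i\<close> rules out \<open>b = c\<close>.\<close>
  then obtain m where m: "less_at I x m b c"
    using le by (auto simp: lectic_le_def lectic_less_def)
  show False
  proof (cases m i rule: linorder_cases)
    \<comment> \<open>Before \<open>i\<close> both \<open>b\<close> and \<open>c\<close> agree with
      \<open>a\<close>, so they cannot differ at \<open>m\<close>. For \<open>m \<ge> i\<close>,
      \<open>x i \<le> b\<close> would force \<open>x i \<le> c\<close>.\<close>
    case less
    then show ?thesis
      using b c m ik by (auto simp: less_at_iff[OF fin])
  qed (use m xi in \<open>auto simp: less_at_iff[OF fin]\<close>)
qed

theorem mainTheorem1:
  fixes I :: "'i::linorder set" and x :: "'i \<Rightarrow> 'a::semilattice_sup" and a a_plus :: 'a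
  assumes "finite I"
    and "generates (x ` I)"
    and "is_next I x a a_plus"
  shows "\<exists>i\<in>I. less_at I x i a (oplus I x a i)
           \<and> (\<forall>k\<in>I. less_at I x k a (oplus I x a k) \<longrightarrow> k \<le> i)
           \<and> a_plus = oplus I x a i"
proof -
  note fin = \<open>finite I\<close>
  obtain i where i: "i \<in> I" "less_at I x i a a_plus"
    using assms(3) by (auto simp: is_next_def lectic_less_def)
  have least: "lectic_le I x a_plus b" if "k \<in> I" "less_at I x k a b" for k b
    using assms(3) that by (auto simp: is_next_def lectic_less_def)
  note oplus = less_at_imp_less_at_oplus[OF fin i(2)]
  \<comment> \<open>Otherwise \<open>a_plus\<close> would be lectically below an element that lies
    below it in the semilattice.\<close>
  have "a_plus = oplus I x a i"
    using least[OF i(1) oplus] less_at_imp_oplus_le[OF fin i(2)] less_at_imp_not_le[OF fin]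
    by (auto simp: lectic_le_def lectic_less_def)
  moreover have "k \<le> i" if "k \<in> I" "less_at I x k a (oplus I x a k)" for k
    using less_at_index_antimono[OF fin i(2) that(2) least[OF that]] .
  ultimately show ?thesis
    using i(1) oplus by blast
qed

end
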